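(* Let $Q\subset\mathbb{R}^d_{\ge 0}\setminus\{\mathbf{0}\}$ be a polytope, let $f$ be a continuous and convex function on $\operatorname{conv}(Q\cup\{\mathbf{0}\})$ with $f(\mathbf{0})=0$, and let $\mu$ be a concave upper bound of $f$ on $Q$. Let $P^0(f,Q)$ be the naïve relaxation (defined using $\mu$). Then $$\operatorname{vol}(P^0(f,Q))=\frac{1}{d+2}\int_{Q}\mu(\mathbf{x})\,d\mathbf{x}-\int_0^1 z^d\int_{Q}f(z\mathbf{x})\,d\mathbf{x}\,dz.$$
   Context: A concave upper bound of $f$ on $Q$ is a concave function $\mu:Q\to\mathbb{R}$ with $\mu(\mathbf{x})\ge f(\mathbf{x})$ for all $\mathbf{x}\in Q$. For $z>0$ and $\mathbf{x}\in z\cdot Q=\{z\mathbf{q}:\mathbf{q}\in Q\}$ write $\tilde\mu(\mathbf{x},z):=z\mu(\mathbf{x}/z)$, and (closure convention) $\tilde\mu(\mathbf{0},0):=0$. The naïve relaxation is $$P^0(f,Q):=\{(\mathbf{x},y,z)\in\mathbb{R}^d\times\mathbb{R}\times\mathbb{R}:\ \tilde\mu(\mathbf{x},z)\ge y\ge f(\mathbf{x}),\ \mathbf{x}\in z\cdot Q,\ 1\ge z\ge 0\}.$$ $\operatorname{vol}$ denotes Lebesgue measure in $\mathbb{R}^{d+2}$, and integrals over $Q$ are with respect to Lebesgue measure in $\mathbb{R}^d$. *)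

theory Defs
  imports "HOL-Analysis.Analysis"
begin

text \<open>Functions on \<open>Q\<close> (or on \<open>conv (Q \<union> {0})\<close>) are total functions on \<open>\<real>\<^sup>d\<close>; their values
  outside the domain of interest are never used.\<close>

definition concave_upper_bound ::
  "'a::real_vector set \<Rightarrow> ('a \<Rightarrow> real) \<Rightarrow> ('a \<Rightarrow> real) \<Rightarrow> bool" where
  "concave_upper_bound Q f \<mu> \<longleftrightarrow> concave_on Q \<mu> \<and> (\<forall>x\<in>Q. \<mu> x \<ge> f x)"

text \<open>The perspective function is only meant for \<open>z > 0\<close> with \<open>x \<in> z \<cdot> Q\<close>, and for
  \<open>(x, z) = (0, 0)\<close>, where it is \<open>0\<close> by the closure convention. Elsewhere the value is
  junk.\<close>

definition perspective :: "('a::real_vector \<Rightarrow> real) \<Rightarrow> 'a \<Rightarrow> real \<Rightarrow> real" where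
  "perspective \<mu> x z = (if z > 0 then z * \<mu> (x /\<^sub>R z) else 0)"

definition naive_relaxation ::
  "('a::real_vector \<Rightarrow> real) \<Rightarrow> ('a \<Rightarrow> real) \<Rightarrow> 'a set \<Rightarrow> ('a \<times> real \<times> real) set" where
  "naive_relaxation \<mu> f Q =
     {(x, y, z). perspective \<mu> x z \<ge> y \<and> y \<ge> f x \<and> x \<in> (\<lambda>q. z *\<^sub>R q) ` Q \<and> 1 \<ge> z \<and> z \<ge> 0}"

end

theory Submission
  imports Defs
begin

text \<open>
  The relaxation \<open>N\<close> is sliced at height \<open>z\<close>. Substituting \<open>x = z q\<close> in the slice turns \<open>x \<in> z \<cdot> Q\<close>
  into \<open>q \<in> Q\<close> with Jacobian \<open>z\<^sup>d\<close>, and the remaining coordinate \<open>y\<close> runs through the interval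
  \<open>[f (z q), z \<mu> q]\<close>. This interval is nonempty, because convexity and \<open>f 0 = 0\<close> give
  \<open>f (z q) \<le> z f q \<le> z \<mu> q\<close>. Hence
  \<open>vol N = \<integral>\<^sub>0\<^sup>1 z\<^sup>d \<integral>\<^sub>Q (z \<mu> q - f (z q)) dq dz\<close>, and \<open>\<integral>\<^sub>0\<^sup>1 z\<^sup>d\<^sup>+\<^sup>1 dz = 1 / (d + 2)\<close> gives the
  formula. The slicing and the substitution are combined in \<open>emeasure_lborel_perspective\<close>.

  What needs care is regularity, since \<open>\<mu>\<close> may be discontinuous on the boundary of \<open>Q\<close> and \<open>N\<close> need
  not be a Borel set. On the interior of \<open>Q\<close> the concave function \<open>\<mu>\<close> is continuous. On \<open>Q\<close> it is
  bounded below, because \<open>f\<close> is, and hence bounded above if the interior is nonempty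
  (\<open>concave_on_bounded_above\<close>). The boundary of a convex set is a null set, and so is the cone over
  it (\<open>cone_over_frontier_null\<close>). So \<open>N\<close> differs by a null set from its Borel part over the interior
  of \<open>Q\<close>, to which Tonelli's theorem applies.

  The argument works for compact convex sets in any Euclidean space, and this is the setting of
  \<open>naive_relaxation_volume\<close>; a polytope is compact and convex.
\<close>

section \<open>Slicing a set and rescaling its slices\<close>

lemma nn_integral_lborel_scaleR:
  fixes g :: "'a::euclidean_space \<Rightarrow> ennreal"
  assumes [measurable]: "g \<in> borel_measurable borel" and "c > 0"
  shows "(\<integral>\<^sup>+x. g x \<partial>lborel) = ennreal (c ^ DIM('a)) * (\<integral>\<^sup>+x. g (c *\<^sub>R x) \<partial>lborel)"
  using \<open>c > 0\<close>
  by (subst lborel_affine[of c 0])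
     (simp_all add: nn_integral_density nn_integral_distr nn_integral_cmult)

text \<open>Tonelli's theorem, with the \<open>x\<close>-coordinate of the slice at height \<open>z\<close> rescaled by \<open>z\<close>: the slices
  \<open>x \<in> z \<cdot> Q\<close> of a cone all become the fixed base \<open>Q\<close>.\<close>

lemma emeasure_lborel_perspective:
  fixes A :: "('a::euclidean_space \<times> real \<times> real) set"
  assumes A: "A \<in> sets borel" and pos: "\<And>x y z. (x, y, z) \<in> A \<Longrightarrow> z > 0"
  shows "emeasure lborel A =
    (\<integral>\<^sup>+z\<in>{0<..}. ennreal (z ^ DIM('a)) *
        (\<integral>\<^sup>+q. emeasure lborel {y. (z *\<^sub>R q, y, z) \<in> A} \<partial>lborel) \<partial>lborel)"
proof -
  have borel_A[measurable]: "A \<in> sets (borel \<Otimes>\<^sub>M (borel \<Otimes>\<^sub>M borel))"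
    using A unfolding borel_prod .
  define s where "s x z = (\<integral>\<^sup>+y. indicator A (x, y, z) \<partial>lborel)" for x z
  have [measurable]: "case_prod s \<in> borel_measurable (borel \<Otimes>\<^sub>M borel)"
    unfolding s_def by measurable
  have s_eq: "s x z = emeasure lborel {y. (x, y, z) \<in> A}" for x z
  proof -
    have sec: "{y. (x, y, z) \<in> A} \<in> sets lborel" by simp
    show ?thesis
      unfolding s_def nn_integral_indicator[OF sec, symmetric]
      by (intro nn_integral_cong) (simp add: indicator_def)
  qed
  have "emeasure lborel A = (\<integral>\<^sup>+p. indicator A p \<partial>(lborel \<Otimes>\<^sub>M (lborel \<Otimes>\<^sub>M lborel)))"
    using A by (simp add: lborel_prod)
  also have "\<dots> = (\<integral>\<^sup>+x. \<integral>\<^sup>+w. indicator A (x, w) \<partial>(lborel \<Otimes>\<^sub>M lborel) \<partial>lborel)"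
    by (subst lborel_prod, subst lborel_pair.nn_integral_fst[symmetric]) (simp_all add: lborel_prod A borel_measurable_indicator)
  also have "\<dots> = (\<integral>\<^sup>+x. \<integral>\<^sup>+z. s x z \<partial>lborel \<partial>lborel)"
    unfolding s_def by (intro nn_integral_cong lborel_pair.nn_integral_snd[symmetric]) simp
  also have "\<dots> = (\<integral>\<^sup>+z. \<integral>\<^sup>+x. s x z \<partial>lborel \<partial>lborel)"
    by (intro lborel_pair.Fubini') simp
  also have "\<dots> = (\<integral>\<^sup>+z\<in>{0<..}. ennreal (z ^ DIM('a)) *
        (\<integral>\<^sup>+q. s (z *\<^sub>R q) z \<partial>lborel) \<partial>lborel)"
  proof (intro nn_integral_cong)
    fix z :: real
    show "(\<integral>\<^sup>+x. s x z \<partial>lborel) =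
      ennreal (z ^ DIM('a)) * (\<integral>\<^sup>+q. s (z *\<^sub>R q) z \<partial>lborel) * indicator {0<..} z"
    proof (cases "z > 0")
      case True
      then show ?thesis
        by (subst nn_integral_lborel_scaleR[where c = z]) simp_all
    next
      case False
      then have "{y. (x, y, z) \<in> A} = {}" for x
        using pos by blast
      then have "s x z = 0" for x
        by (simp add: s_eq)
      with False show ?thesis by simp
    qed
  qed
  finally show ?thesis unfolding s_eq .
qed

section \<open>Concave functions and integrals over convex sets\<close>

text \<open>A point \<open>x\<close> of \<open>S\<close> is reflected, with a fixed contraction factor \<open>s\<close>, through the centre \<open>a\<close> of a
  ball inside \<open>S\<close>. The image \<open>p\<close> lies in the ball, and concavity at \<open>a\<close>, which lies between \<open>p\<close> and
  \<open>x\<close>, bounds \<open>g x\<close> in terms of \<open>g a\<close> and the lower bound for \<open>g p\<close>.\<close>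

lemma concave_on_bounded_above:
  fixes S :: "'a::euclidean_space set" and g :: "'a \<Rightarrow> real"
  assumes conc: "concave_on S g" and bdd: "bounded S" and int: "interior S \<noteq> {}"
    and low: "\<And>x. x \<in> S \<Longrightarrow> b \<le> g x"
  obtains B where "\<And>x. x \<in> S \<Longrightarrow> g x \<le> B"
proof -
  obtain a r where "r > 0" and r: "ball a r \<subseteq> S"
    using int by (meson all_not_in_conv mem_interior)
  obtain D where "D > 0" and D: "\<And>x. x \<in> S \<Longrightarrow> norm (x - a) < D"
    using bdd by (metis bounded_subset_ballD dist_norm dist_commute mem_ball subsetD)
  define s where "s = r / D"
  have "s > 0" using \<open>r > 0\<close> \<open>D > 0\<close> by (simp add: s_def)
  have "g x \<le> ((1 + s) * g a - b) / s" if "x \<in> S" for x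
  proof -
    define p where "p = a - s *\<^sub>R (x - a)"
    have "norm (s *\<^sub>R (x - a)) < r"
      using D[OF that] \<open>r > 0\<close> \<open>D > 0\<close> by (simp add: s_def pos_divide_less_eq)
    then have "p \<in> ball a r" by (simp add: p_def dist_norm)
    then have "p \<in> S" using r by blast
    have "(1 / (1 + s)) *\<^sub>R p + (s / (1 + s)) *\<^sub>R x = (1 / (1 + s)) *\<^sub>R (p + s *\<^sub>R x)"
      by (simp add: scaleR_add_right)
    also have "p + s *\<^sub>R x = (1 + s) *\<^sub>R a"
      by (simp add: p_def algebra_simps)
    finally have a_eq: "a = (1 / (1 + s)) *\<^sub>R p + (s / (1 + s)) *\<^sub>R x"
      using \<open>s > 0\<close> by simp
    have "1 / (1 + s) + s / (1 + s) = 1"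
      using \<open>s > 0\<close> by (simp flip: add_divide_distrib)
    with conc \<open>p \<in> S\<close> that \<open>s > 0\<close> have "1 / (1 + s) * g p + s / (1 + s) * g x \<le> g a"
      unfolding concave_on_iff by (subst a_eq) (metis divide_nonneg_pos
        add_pos_pos less_imp_le zero_le_one zero_less_one)
    then have "(g p + s * g x) / (1 + s) \<le> g a" by (simp add: add_divide_distrib)
    then have "g p + s * g x \<le> (1 + s) * g a"
      using \<open>s > 0\<close> by (simp add: field_simps)
    with low[OF \<open>p \<in> S\<close>] show ?thesis
      using \<open>s > 0\<close> by (simp add: field_simps)
  qed
  then show thesis by (rule that)
qed

lemma null_sets_lborel_frontier_convex:
  fixes Q :: "'a::euclidean_space set"
  assumes "convex Q"
  shows "frontier Q \<in> null_sets lborel"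
  using negligible_convex_frontier[OF assms]
  by (simp add: negligible_iff_null_sets null_sets_completion_iff)

text \<open>Integrability and the value of the integral depend only on the behaviour of \<open>g\<close> in the interior;
  in particular \<open>g\<close> may be arbitrary on the boundary.\<close>

lemma set_integral_lebesgue_convex:
  fixes Q :: "'a::euclidean_space set" and g :: "'a \<Rightarrow> real"
  assumes Q: "convex Q" "bounded Q"
    and meas[measurable]: "(\<lambda>x. indicator (interior Q) x * g x) \<in> borel_measurable borel"
    and bound: "\<And>x. x \<in> interior Q \<Longrightarrow> \<bar>g x\<bar> \<le> B"
  shows "integrable lborel (\<lambda>x. indicator (interior Q) x * g x)"
    and "set_integrable lebesgue Q g"
    and "(LINT x:Q|lebesgue. g x) = (\<integral>x. indicator (interior Q) x * g x \<partial>lborel)"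
proof -
  show int: "integrable lborel (\<lambda>x. indicator (interior Q) x * g x)"
  proof (rule integrableI_bounded_set[where A = "interior Q" and B = B])
    show "emeasure lborel (interior Q) < \<infinity>"
      using \<open>bounded Q\<close> by (intro emeasure_bounded_finite bounded_interior)
  qed (use bound in auto)
  have "AE x in lebesgue. x \<notin> frontier Q"
    using null_sets_lborel_frontier_convex[OF \<open>convex Q\<close>]
    by (intro AE_completion AE_not_in)
  then have AE: "AE x in lebesgue. indicator (interior Q) x * g x = indicator Q x *\<^sub>R g x"
  proof eventually_elim
    case (elim x)
    then have "x \<in> Q \<longleftrightarrow> x \<in> interior Q"
      using closure_subset[of Q] interior_subset[of Q] by (auto simp: frontier_def)
    then show ?case by (simp add: indicator_def)
  qed
  have leb: "(\<lambda>x. indicator (interior Q) x * g x) \<in> borel_measurable lebesgue"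
    by (intro measurable_completion) simp
  have leb': "(\<lambda>x. indicator Q x *\<^sub>R g x) \<in> borel_measurable lebesgue"
    using leb AE by (rule borel_measurable_AE)
  have "integrable lebesgue (\<lambda>x. indicator (interior Q) x * g x)"
    using int by (simp add: integrable_completion)
  then show "set_integrable lebesgue Q g"
    unfolding set_integrable_def using leb' AE by (rule integrable_cong_AE_imp)
  have "(LINT x:Q|lebesgue. g x) = (\<integral>x. indicator (interior Q) x * g x \<partial>lebesgue)"
    unfolding set_lebesgue_integral_def using AE
    by (intro integral_cong_AE leb leb') auto
  then show "(LINT x:Q|lebesgue. g x) = (\<integral>x. indicator (interior Q) x * g x \<partial>lborel)"
    by (simp add: integral_completion)
qed

section \<open>The volume of the relaxation\<close>

lemma cone_over_frontier_null:
  fixes Q :: "'a::euclidean_space set"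
  assumes "convex Q"
  shows "{(x, y, z). 0 < z \<and> x /\<^sub>R z \<in> frontier Q} \<in>
    null_sets (lborel :: ('a \<times> real \<times> real) measure)" (is "?C \<in> _")
proof -
  have [measurable]: "frontier Q \<in> sets borel" by simp
  have "{p \<in> space (borel \<Otimes>\<^sub>M (borel \<Otimes>\<^sub>M borel)).
      0 < snd (snd p) \<and> fst p /\<^sub>R snd (snd p) \<in> frontier Q}
      \<in> sets (borel \<Otimes>\<^sub>M (borel \<Otimes>\<^sub>M (borel :: real measure)))"
    by measurable
  also have "{p \<in> space (borel \<Otimes>\<^sub>M (borel \<Otimes>\<^sub>M borel)).
      0 < snd (snd p) \<and> fst p /\<^sub>R snd (snd p) \<in> frontier Q} = ?C"
    by (auto simp: space_pair_measure)
  finally have C: "?C \<in> sets borel" unfolding borel_prod .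
  have AE: "AE q in lborel. q \<notin> frontier Q"
    using null_sets_lborel_frontier_convex[OF assms] by (rule AE_not_in)
  have "emeasure lborel ?C = (\<integral>\<^sup>+z\<in>{0<..}. ennreal (z ^ DIM('a)) *
      (\<integral>\<^sup>+q. emeasure lborel {y. (z *\<^sub>R q, y, z) \<in> ?C} \<partial>lborel) \<partial>lborel)"
    by (rule emeasure_lborel_perspective[OF C]) auto
  also have "\<dots> = (\<integral>\<^sup>+z. 0 \<partial>(lborel :: real measure))"
  proof (intro nn_integral_cong)
    fix z :: real
    have "(\<integral>\<^sup>+q. emeasure lborel {y. (z *\<^sub>R q, y, z) \<in> ?C} \<partial>lborel) =
        (\<integral>\<^sup>+q. 0 \<partial>(lborel :: 'a measure))" if "z > 0"
      using AE that by (intro nn_integral_cong_AE) (auto elim!: eventually_mono)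
    then show "ennreal (z ^ DIM('a)) *
        (\<integral>\<^sup>+q. emeasure lborel {y. (z *\<^sub>R q, y, z) \<in> ?C} \<partial>lborel) * indicator {0<..} z = 0"
      by (cases "z > 0") simp_all
  qed
  finally show ?thesis using C by (simp add: null_setsI)
qed

lemma naive_relaxation_volume:
  fixes Q :: "'a::euclidean_space set" and f \<mu> :: "'a \<Rightarrow> real"
  defines "N \<equiv> naive_relaxation \<mu> f Q"
  defines "h \<equiv> (\<lambda>z. LINT x:Q|lebesgue. f (z *\<^sub>R x))"
  assumes Q: "compact Q" "convex Q"
    and cont: "continuous_on (convex hull (Q \<union> {0})) f"
    and conv: "convex_on (convex hull (Q \<union> {0})) f"
    and f0: "f 0 = 0"
    and upper: "concave_upper_bound Q f \<mu>"
  shows "N \<in> lmeasurable"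
    and "set_integrable lebesgue Q \<mu>"
    and "\<And>z. z \<in> {0..1} \<Longrightarrow> set_integrable lebesgue Q (\<lambda>x. f (z *\<^sub>R x))"
    and "set_integrable lebesgue {0..1} (\<lambda>z. z ^ DIM('a) * h z)"
    and "measure lebesgue N = 1 / (real DIM('a) + 2) * (LINT x:Q|lebesgue. \<mu> x)
           - (LINT z:{0..1}|lebesgue. z ^ DIM('a) * h z)"
proof -
  \<comment> \<open>\<open>F\<close> and \<open>m\<close> are Borel functions on the whole space that agree with \<open>f\<close> on \<open>conv (Q \<union> {0})\<close> and
    with \<open>\<mu>\<close> on the interior of \<open>Q\<close>.\<close>
  define U where "U = interior Q"
  define K where "K = convex hull (Q \<union> {0})"
  define n where "n = DIM('a)"
  define F where "F x = indicator K x * f x" for x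
  define m where "m q = indicator U q * \<mu> q" for q
  have conc: "concave_on Q \<mu>" and above: "\<And>x. x \<in> Q \<Longrightarrow> f x \<le> \<mu> x"
    using upper by (auto simp: concave_upper_bound_def)
  have U[measurable]: "U \<in> sets borel" and "U \<subseteq> Q" and "open U"
    by (auto simp: U_def interior_subset)
  have "bounded Q" using Q compact_imp_bounded by blast
  have "compact K" unfolding K_def using Q by (intro compact_convex_hull compact_Un) auto
  then have [measurable]: "K \<in> sets borel" by (simp add: borel_compact)
  have "convex K" by (simp add: K_def)
  have "Q \<subseteq> K" "0 \<in> K" unfolding K_def using hull_subset[of "Q \<union> {0}" convex] by auto
  have zK: "z *\<^sub>R q \<in> K" if "q \<in> Q" "0 \<le> z" "z \<le> 1" for q z
    using convexD_alt[OF \<open>convex K\<close> \<open>0 \<in> K\<close>, of q z] that \<open>Q \<subseteq> K\<close> by auto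
  have F[measurable]: "F \<in> borel_measurable borel"
    using borel_measurable_continuous_on_indicator[OF \<open>K \<in> sets borel\<close>, of f] cont
    unfolding F_def K_def[symmetric] by simp
  have "continuous_on U \<mu>"
    using convex_on_continuous[OF \<open>open U\<close>, of "\<lambda>x. - \<mu> x"] conc \<open>U \<subseteq> Q\<close>
      convex_on_subset[of Q "\<lambda>x. - \<mu> x" U] convex_interior[OF \<open>convex Q\<close>]
    unfolding concave_on_def U_def
    by (metis (no_types, lifting) add.inverse_inverse continuous_on_cong continuous_on_minus)
  then have m[measurable]: "m \<in> borel_measurable borel"
    using borel_measurable_continuous_on_indicator[OF U, of \<mu>] unfolding m_def by simp
  have "bounded (f ` K)"
    using compact_continuous_image[OF cont] \<open>compact K\<close> compact_imp_bounded
    by (simp add: K_def)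
  then obtain B where B: "\<And>x. x \<in> K \<Longrightarrow> \<bar>f x\<bar> \<le> B"
    by (auto simp: bounded_iff)
  have lowb: "- B \<le> \<mu> x" if "x \<in> Q" for x
    using B[of x] above[OF that] that \<open>Q \<subseteq> K\<close> by fastforce
  obtain C where C: "\<And>x. x \<in> U \<Longrightarrow> \<bar>\<mu> x\<bar> \<le> C"
  proof (cases "U = {}")
    case False
    then obtain C' where "\<And>x. x \<in> Q \<Longrightarrow> \<mu> x \<le> C'"
      using concave_on_bounded_above[OF conc \<open>bounded Q\<close>] lowb unfolding U_def by metis
    with lowb \<open>U \<subseteq> Q\<close> show thesis
      by (intro that[of "max B C'"]) (auto simp: abs_le_iff, (smt (verit) subsetD)+)
  qed (use that in auto)
  have m_eq: "(\<lambda>x. indicator (interior Q) x * \<mu> x) = m"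
    by (simp add: m_def U_def fun_eq_iff)
  have int_m: "integrable lborel m" and mu_int: "set_integrable lebesgue Q \<mu>"
    and mu_eq: "(LINT x:Q|lebesgue. \<mu> x) = integral\<^sup>L lborel m"
    using set_integral_lebesgue_convex[of Q \<mu> C] Q \<open>bounded Q\<close> m C
    unfolding m_eq U_def by auto
  define H where "H z = (\<integral>q. indicator U q * F (z *\<^sub>R q) \<partial>lborel)" for z
  have H_meas[measurable]: "H \<in> borel_measurable borel"
    unfolding H_def by measurable
  have FU: "(\<lambda>q. indicator (interior Q) q * f (z *\<^sub>R q)) = (\<lambda>q. indicator U q * F (z *\<^sub>R q))"
    if "0 \<le> z" "z \<le> 1" for z
    using zK that \<open>U \<subseteq> Q\<close> by (auto simp: fun_eq_iff F_def U_def indicator_def)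
  have f_int: "integrable lborel (\<lambda>q. indicator U q * F (z *\<^sub>R q))"
      "set_integrable lebesgue Q (\<lambda>x. f (z *\<^sub>R x))" "h z = H z"
    if z: "0 \<le> z" "z \<le> 1" for z
  proof -
    have 1: "(\<lambda>q. indicator (interior Q) q * f (z *\<^sub>R q)) \<in> borel_measurable borel"
      unfolding FU[OF z] by measurable
    have 2: "\<bar>f (z *\<^sub>R x)\<bar> \<le> B" if "x \<in> interior Q" for x
      using that \<open>U \<subseteq> Q\<close> z by (intro B zK) (auto simp: U_def)
    show "integrable lborel (\<lambda>q. indicator U q * F (z *\<^sub>R q))"
      "set_integrable lebesgue Q (\<lambda>x. f (z *\<^sub>R x))" "h z = H z"
      using set_integral_lebesgue_convex[OF \<open>convex Q\<close> \<open>bounded Q\<close> 1 2]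
      unfolding FU[OF z] h_def H_def by auto
  qed
  show "set_integrable lebesgue Q \<mu>" by (rule mu_int)
  show "set_integrable lebesgue Q (\<lambda>x. f (z *\<^sub>R x))" if "z \<in> {0..1}" for z
    using f_int that by simp

  define I where "I = integral\<^sup>L lborel m"
  have "emeasure lborel U < \<infinity>"
    using \<open>bounded Q\<close> unfolding U_def by (intro emeasure_bounded_finite bounded_interior)
  have H_bound: "\<bar>H z\<bar> \<le> B * measure lborel U" if z: "0 \<le> z" "z \<le> 1" for z
  proof -
    have "\<bar>H z\<bar> \<le> (\<integral>q. \<bar>indicator U q * F (z *\<^sub>R q)\<bar> \<partial>lborel)"
      unfolding H_def by (rule integral_abs_bound)
    also have "\<dots> \<le> (\<integral>q. B * indicator U q \<partial>lborel)"
    proof (rule integral_mono)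
      show "integrable lborel (\<lambda>q. \<bar>indicator U q * F (z *\<^sub>R q)\<bar>)"
        using f_int(1)[OF z] by simp
      show "integrable lborel (\<lambda>q. B * indicator U q)"
        using \<open>emeasure lborel U < \<infinity>\<close> by simp
      show "\<bar>indicator U q * F (z *\<^sub>R q)\<bar> \<le> B * indicator U q" for q
        using B[OF zK, of q z] z \<open>U \<subseteq> Q\<close> by (auto simp: F_def indicator_def)
    qed
    finally show ?thesis by simp
  qed
  have int_H: "integrable lborel (\<lambda>z. indicator {0..1} z * (z ^ n * H z))"
  proof (rule integrableI_bounded_set[where A = "{0..1}" and B = "B * measure lborel U"])
    show "AE z in lborel. z \<in> {0..1} \<longrightarrow>
        norm (indicator {0..1} z * (z ^ n * H z)) \<le> B * measure lborel U"
    proof (intro AE_I2 impI)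
      fix z :: real assume "z \<in> {0..1}"
      then have "\<bar>z ^ n\<bar> * \<bar>H z\<bar> \<le> 1 * (B * measure lborel U)"
        by (intro mult_mono H_bound) (auto simp: power_le_one)
      with \<open>z \<in> {0..1}\<close> show "norm (indicator {0..1} z * (z ^ n * H z)) \<le> B * measure lborel U"
        by (simp add: abs_mult)
    qed
  qed auto
  have hH: "indicator {0..1} z *\<^sub>R (z ^ n * h z) = indicator {0..1} z * (z ^ n * H z)" for z :: real
    using f_int(3)[of z] by (simp add: indicator_def)
  show "set_integrable lebesgue {0..1} (\<lambda>z. z ^ DIM('a) * h z)"
    using int_H unfolding set_integrable_def n_def[symmetric] hH by (simp add: integrable_completion)
  have h_eq: "(LINT z:{0..1}|lebesgue. z ^ n * h z) = (\<integral>z. indicator {0..1} z * (z ^ n * H z) \<partial>lborel)"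
    unfolding set_lebesgue_integral_def hH by (simp add: integral_completion)
  have int_z: "integrable lborel (\<lambda>z. indicator {0..1} z * z ^ Suc n :: real)"
    by (rule integrableI_bounded_set[where A = "{0..1}" and B = 1])
       (auto simp: power_le_one abs_mult intro!: AE_I2 mult_le_one)
  have z_eq: "(\<integral>z. indicator {0..1} z * z ^ Suc n \<partial>lborel) = 1 / (real n + 2)"
    using integral_power[of 0 1 "Suc n"] by (simp add: mult.commute add.commute)

  \<comment> \<open>The Borel part of \<open>N\<close>, lying over the interior of \<open>Q\<close>.\<close>
  define N' where "N' = {(x, y, z). 0 < z \<and> z \<le> 1 \<and> x /\<^sub>R z \<in> U \<and> F x \<le> y \<and> y \<le> z * m (x /\<^sub>R z)}"
  have N': "N' \<in> sets borel"
  proof -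
    have "{p \<in> space (borel \<Otimes>\<^sub>M (borel \<Otimes>\<^sub>M borel)). 0 < snd (snd p) \<and> snd (snd p) \<le> 1 \<and>
        fst p /\<^sub>R snd (snd p) \<in> U \<and> F (fst p) \<le> fst (snd p) \<and>
        fst (snd p) \<le> snd (snd p) * m (fst p /\<^sub>R snd (snd p))}
        \<in> sets (borel \<Otimes>\<^sub>M (borel \<Otimes>\<^sub>M (borel :: real measure)))"
      by measurable
    also have "{p \<in> space (borel \<Otimes>\<^sub>M (borel \<Otimes>\<^sub>M borel)). 0 < snd (snd p) \<and> snd (snd p) \<le> 1 \<and>
        fst p /\<^sub>R snd (snd p) \<in> U \<and> F (fst p) \<le> fst (snd p) \<and>
        fst (snd p) \<le> snd (snd p) * m (fst p /\<^sub>R snd (snd p))} = N'"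
      by (auto simp: N'_def space_pair_measure)
    finally show ?thesis unfolding borel_prod .
  qed
  \<comment> \<open>The interval of values \<open>y\<close> over \<open>(z q, z)\<close> is nonempty, so its length is the plain difference.\<close>
  have gap: "F (z *\<^sub>R q) \<le> z * m q" if "q \<in> U" "0 < z" "z \<le> 1" for q z
  proof -
    have "q \<in> Q" using that \<open>U \<subseteq> Q\<close> by blast
    have "f (z *\<^sub>R q) \<le> (1 - z) * f 0 + z * f q"
      using convex_onD[OF conv, of z 0 q] that \<open>q \<in> Q\<close> \<open>Q \<subseteq> K\<close> \<open>0 \<in> K\<close> by (auto simp: K_def)
    also have "\<dots> \<le> z * \<mu> q" using above[OF \<open>q \<in> Q\<close>] that by (simp add: f0)
    finally show ?thesis using that zK[OF \<open>q \<in> Q\<close>] by (simp add: F_def m_def)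
  qed
  have slice: "(\<integral>\<^sup>+q. emeasure lborel {y. (z *\<^sub>R q, y, z) \<in> N'} \<partial>lborel) = ennreal (z * I - H z)"
    and slice_nonneg: "0 \<le> z * I - H z" if z: "0 < z" "z \<le> 1" for z
  proof -
    have eq: "emeasure lborel {y. (z *\<^sub>R q, y, z) \<in> N'} =
        ennreal (z * m q - indicator U q * F (z *\<^sub>R q))" for q
    proof (cases "q \<in> U")
      case True
      then have "{y. (z *\<^sub>R q, y, z) \<in> N'} = {F (z *\<^sub>R q)..z * m q}"
        using z by (auto simp: N'_def)
      then show ?thesis using gap[OF True z] True by simp
    next
      case False
      then show ?thesis using z by (simp add: N'_def m_def)
    qed
    have nonneg: "0 \<le> z * m q - indicator U q * F (z *\<^sub>R q)" for q
      using gap[OF _ z, of q] by (cases "q \<in> U") (auto simp: m_def)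
    have int: "integrable lborel (\<lambda>q. z * m q - indicator U q * F (z *\<^sub>R q))"
      using int_m f_int(1)[of z] z by simp
    have I: "(\<integral>q. z * m q - indicator U q * F (z *\<^sub>R q) \<partial>lborel) = z * I - H z"
      using int_m f_int(1)[of z] z by (simp add: I_def H_def)
    show "(\<integral>\<^sup>+q. emeasure lborel {y. (z *\<^sub>R q, y, z) \<in> N'} \<partial>lborel) = ennreal (z * I - H z)"
      unfolding eq using nonneg by (simp add: nn_integral_eq_integral[OF int] I)
    show "0 \<le> z * I - H z"
      unfolding I[symmetric] by (rule Bochner_Integration.integral_nonneg) (use nonneg in auto)
  qed
  define V where "V = I / (real n + 2) - (\<integral>z. indicator {0..1} z * (z ^ n * H z) \<partial>lborel)"
  have split: "indicator {0..1} z * (z ^ n * (z * I - H z)) =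
      I * (indicator {0..1} z * z ^ Suc n) - indicator {0..1} z * (z ^ n * H z)" for z :: real
    by (simp add: algebra_simps)
  have int_V: "integrable lborel (\<lambda>z. indicator {0..1} z * (z ^ n * (z * I - H z)))"
    unfolding split using int_z int_H by simp
  have V_eq: "V = (\<integral>z. indicator {0..1} z * (z ^ n * (z * I - H z)) \<partial>lborel)"
  proof -
    have "V = I * (\<integral>z. indicator {0..1} z * z ^ Suc n \<partial>lborel) -
        (\<integral>z. indicator {0..1} z * (z ^ n * H z) \<partial>lborel)"
      unfolding z_eq V_def by simp
    then show ?thesis
      unfolding split using int_z int_H by simp
  qed
  have V_AE: "AE z in lborel. 0 \<le> indicator {0..1} z * (z ^ n * (z * I - H z))"
    using AE_lborel_singleton[of 0] slice_nonneg
    by (auto elim!: eventually_mono simp: indicator_def)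
  have "0 \<le> V" unfolding V_eq using V_AE by (rule integral_nonneg_AE)
  have "emeasure lborel N' = (\<integral>\<^sup>+z\<in>{0<..}. ennreal (z ^ DIM('a)) *
        (\<integral>\<^sup>+q. emeasure lborel {y. (z *\<^sub>R q, y, z) \<in> N'} \<partial>lborel) \<partial>lborel)"
    by (rule emeasure_lborel_perspective[OF N']) (auto simp: N'_def)
  also have "\<dots> = (\<integral>\<^sup>+z. ennreal (indicator {0<..1} z * (z ^ n * (z * I - H z))) \<partial>lborel)"
  proof (intro nn_integral_cong)
    fix z :: real
    consider "z \<le> 0" | "0 < z" "z \<le> 1" | "1 < z" by linarith
    then show "ennreal (z ^ DIM('a)) * (\<integral>\<^sup>+q. emeasure lborel {y. (z *\<^sub>R q, y, z) \<in> N'} \<partial>lborel) *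
        indicator {0<..} z = ennreal (indicator {0<..1} z * (z ^ n * (z * I - H z)))"
    proof cases
      case 2
      then show ?thesis
        using slice slice_nonneg by (simp add: n_def ennreal_mult)
    next
      case 3
      then have "{y. (z *\<^sub>R q, y, z) \<in> N'} = {}" for q by (auto simp: N'_def)
      with 3 show ?thesis by simp
    qed simp
  qed
  \<comment> \<open>The point \<open>z = 0\<close> is a null set.\<close>
  also have "\<dots> = (\<integral>\<^sup>+z. ennreal (indicator {0..1} z * (z ^ n * (z * I - H z))) \<partial>lborel)"
    using AE_lborel_singleton[of 0]
    by (intro nn_integral_cong_AE) (auto elim!: eventually_mono simp: indicator_def)
  also have "\<dots> = ennreal V"
    unfolding V_eq using int_V V_AE by (rule nn_integral_eq_integral)
  finally have em: "emeasure lborel N' = ennreal V" .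

  have N_mem: "(x, y, z) \<in> N \<longleftrightarrow> x /\<^sub>R z \<in> Q \<and> z \<le> 1 \<and> f x \<le> y \<and> y \<le> z * \<mu> (x /\<^sub>R z)"
    if "z > 0" for x y z
  proof -
    have "x \<in> (\<lambda>q. z *\<^sub>R q) ` Q \<longleftrightarrow> x /\<^sub>R z \<in> Q"
    proof
      assume "x /\<^sub>R z \<in> Q"
      then have "z *\<^sub>R (x /\<^sub>R z) \<in> (\<lambda>q. z *\<^sub>R q) ` Q" by (rule imageI)
      with that show "x \<in> (\<lambda>q. z *\<^sub>R q) ` Q" by simp
    qed (use that in auto)
    then show ?thesis using that by (auto simp: N_def naive_relaxation_def perspective_def)
  qed
  have N'_iff: "(x, y, z) \<in> N' \<longleftrightarrow> (x, y, z) \<in> N \<and> x /\<^sub>R z \<in> U" if "z > 0" for x y z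
  proof (cases "x /\<^sub>R z \<in> U \<and> z \<le> 1")
    case True
    then have "F x = f x"
      using zK[of "x /\<^sub>R z" z] that \<open>U \<subseteq> Q\<close> by (auto simp: F_def)
    with True show ?thesis
      using that \<open>U \<subseteq> Q\<close> by (auto simp: N'_def N_mem m_def)
  next
    case False
    then show ?thesis using that by (auto simp: N'_def N_mem)
  qed
  have "N' \<subseteq> N" using N'_iff by (auto simp: N'_def)
  have rest: "N - N' \<subseteq> insert (0, 0, 0) {(x, y, z). 0 < z \<and> x /\<^sub>R z \<in> frontier Q}"
  proof
    fix p assume p: "p \<in> N - N'"
    obtain x y z where [simp]: "p = (x, y, z)" by (cases p)
    show "p \<in> insert (0, 0, 0) {(x, y, z). 0 < z \<and> x /\<^sub>R z \<in> frontier Q}"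
    proof (cases "z > 0")
      case True
      with p have "x /\<^sub>R z \<in> Q" "x /\<^sub>R z \<notin> U" using N_mem N'_iff by auto
      then have "x /\<^sub>R z \<in> frontier Q"
        using closure_subset by (auto simp: frontier_def U_def)
      with True show ?thesis by simp
    next
      case False
      with p show ?thesis
        \<comment> \<open>The slice of \<open>N\<close> at \<open>z = 0\<close> is at most the origin, as \<open>0 \<ge> y \<ge> f 0 = 0\<close>.\<close>
        using f0 by (auto simp: N_def naive_relaxation_def perspective_def)
    qed
  qed
  have "insert (0, 0, 0) {(x, y, z). 0 < z \<and> x /\<^sub>R z \<in> frontier Q} \<in>
      null_sets (lebesgue :: ('a \<times> real \<times> real) measure)"
    using cone_over_frontier_null[OF \<open>convex Q\<close>] by (simp add: null_sets_completionI)
  with rest have null: "N - N' \<in> null_sets lebesgue"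
    by (rule null_sets_completion_subset)
  have "N = N' \<union> (N - N')" using \<open>N' \<subseteq> N\<close> by blast
  moreover have "N' \<in> sets lebesgue" using N' by simp
  ultimately have "N \<in> sets lebesgue" "emeasure lebesgue N = emeasure lebesgue N'"
    using null by (metis null_setsD2 sets.Un, metis emeasure_Un_null_set null)
  moreover have "emeasure lebesgue N' = ennreal V" using N' em by simp
  ultimately have N: "N \<in> sets lebesgue" "emeasure lebesgue N = ennreal V" by simp_all
  then show "N \<in> lmeasurable" by (intro fmeasurableI) auto
  have "measure lebesgue N = V"
    using N \<open>0 \<le> V\<close> by (simp add: measure_def)
  then show "measure lebesgue N = 1 / (real DIM('a) + 2) * (LINT x:Q|lebesgue. \<mu> x)
           - (LINT z:{0..1}|lebesgue. z ^ DIM('a) * h z)"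
    using mu_eq h_eq by (simp add: V_def I_def n_def)
qed

theorem theorem2p2:
  fixes Q :: "(real ^ 'd) set" and f \<mu> :: "real ^ 'd \<Rightarrow> real"
  assumes "polytope Q"
    and "Q \<subseteq> {x. \<forall>i. x $ i \<ge> 0} - {0}"
    and "continuous_on (convex hull (Q \<union> {0})) f"
    and "convex_on (convex hull (Q \<union> {0})) f"
    and "f 0 = 0"
    and "concave_upper_bound Q f \<mu>"
  shows "naive_relaxation \<mu> f Q \<in> lmeasurable \<and>
         set_integrable lebesgue Q \<mu> \<and>
         (\<forall>z\<in>{0..1}. set_integrable lebesgue Q (\<lambda>x. f (z *\<^sub>R x))) \<and>
         set_integrable lebesgue {0..1}
           (\<lambda>z. z ^ CARD('d) * (LINT x:Q|lebesgue. f (z *\<^sub>R x))) \<and>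
         measure lebesgue (naive_relaxation \<mu> f Q) =
           1 / (real CARD('d) + 2) * (LINT x:Q|lebesgue. \<mu> x)
           - (LINT z:{0..1}|lebesgue. z ^ CARD('d) * (LINT x:Q|lebesgue. f (z *\<^sub>R x)))"
proof -
  have Q: "compact Q" "convex Q"
    using \<open>polytope Q\<close> by (simp_all add: polytope_imp_compact polytope_imp_convex)
  show ?thesis
    using naive_relaxation_volume[OF Q assms(3-6)] by (simp add: DIM_cart)
qed

end
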